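(* Let $(X,d)$ be a nonempty pseudometric space. Then the following conditions are equivalent: (i) $(X,d)$ is a pseudorectangle. (ii) If $Q$ is the partition of $X$ corresponding to $\sim_d$, then $Q$ has exactly four blocks and $Q\otimes_3 Q=P_{d^{-1}}$. (iii) There is a partition $Q$ of $X$ into exactly four blocks such that $Q\otimes_3 Q=P_{d^{-1}}$.
   Context: A pseudometric on a set $X$ is a function $d\colon X^2\to\mathbb{R}$ that is non-negative, symmetric, satisfies $d(x,x)=0$ for all $x$, and satisfies the triangle inequality. The relation $x\sim_d y :\Leftrightarrow d(x,y)=0$ is an equivalence relation on $X$; the partition corresponding to it is the set of its equivalence classes. Blocks of a partition are nonempty. Write $d(X^2)=\{d(x,y):x,y\in X\}$ and $P_{d^{-1}}:=\{d^{-1}(t): t\in d(X^2)\}$, where $d^{-1}(t)=\{\langle x,y\rangle\in X^2: d(x,y)=t\}$. A metric subspace of $(X,d)$ is a subset $Y\subseteq X$ such that $d|_{Y^2}$ is a metric. A metric space is strongly rigid if $d(x,y)=d(u,v)\neq 0$ implies $\{x,y\}=\{u,v\}$. A pseudometric space $(X,d)$ is a pseudorectangle if all three-point metric subspaces of $(X,d)$ are strongly rigid and pairwise isometric and, in addition, there is a four-point metric subspace $Y$ of $(X,d)$ such that for every $x\in X$ there is $y\in Y$ with $d(x,y)=0$. For a partition $Q=\{X_1,X_2,X_3,X_4\}$ of $X$ into exactly four blocks, $Q\otimes_3 Q$ is the partition of $X^2$ with the four blocks $\bigcup_{i=1}^4X_i^2$, $(X_1\times X_2)\cup(X_2\times X_1)\cup(X_3\times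 X_4)\cup(X_4\times X_3)$, $(X_1\times X_3)\cup(X_3\times X_1)\cup(X_2\times X_4)\cup(X_4\times X_2)$, $(X_1\times X_4)\cup(X_4\times X_1)\cup(X_2\times X_3)\cup(X_3\times X_2)$ (this does not depend on the numbering of the blocks). *)

theory Defs
  imports "HOL-Analysis.Analysis"
begin

text \<open>All notions are relative to a carrier and ignore the values of \<open>d\<close> outside it.
  The library's \<open>Metric_space\<close> also demands non-negativity and symmetry off the carrier;
  lemma \<open>metric_on_iff_Metric_space\<close> gives the exact relation.\<close>

definition pseudometric_on :: "'a set \<Rightarrow> ('a \<Rightarrow> 'a \<Rightarrow> real) \<Rightarrow> bool" where
  "pseudometric_on X d \<longleftrightarrow>
     (\<forall>x\<in>X. \<forall>y\<in>X. 0 \<le> d x y) \<and>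
     (\<forall>x\<in>X. \<forall>y\<in>X. d x y = d y x) \<and>
     (\<forall>x\<in>X. d x x = 0) \<and>
     (\<forall>x\<in>X. \<forall>y\<in>X. \<forall>z\<in>X. d x z \<le> d x y + d y z)"

definition metric_on :: "'a set \<Rightarrow> ('a \<Rightarrow> 'a \<Rightarrow> real) \<Rightarrow> bool" where
  "metric_on X d \<longleftrightarrow> pseudometric_on X d \<and> (\<forall>x\<in>X. \<forall>y\<in>X. d x y = 0 \<longrightarrow> x = y)"

lemma metric_on_iff_Metric_space:
  "metric_on X d \<longleftrightarrow> Metric_space X (\<lambda>x y. if x \<in> X \<and> y \<in> X then d x y else 0)"
  unfolding metric_on_def pseudometric_on_def Metric_space_def by (auto split: if_splits)

definition metric_subspace :: "'a set \<Rightarrow> ('a \<Rightarrow> 'a \<Rightarrow> real) \<Rightarrow> 'a set \<Rightarrow> bool" where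
  "metric_subspace X d Y \<longleftrightarrow> Y \<subseteq> X \<and> metric_on Y d"

definition strongly_rigid :: "'a set \<Rightarrow> ('a \<Rightarrow> 'a \<Rightarrow> real) \<Rightarrow> bool" where
  "strongly_rigid Y d \<longleftrightarrow> metric_on Y d \<and>
     (\<forall>x\<in>Y. \<forall>y\<in>Y. \<forall>u\<in>Y. \<forall>v\<in>Y. d x y = d u v \<and> d u v \<noteq> 0 \<longrightarrow> {x, y} = {u, v})"

definition isometric :: "'a set \<Rightarrow> ('a \<Rightarrow> 'a \<Rightarrow> real) \<Rightarrow> 'b set \<Rightarrow> ('b \<Rightarrow> 'b \<Rightarrow> real) \<Rightarrow> bool" where
  "isometric Y d Z e \<longleftrightarrow> (\<exists>f. bij_betw f Y Z \<and> (\<forall>x\<in>Y. \<forall>y\<in>Y. e (f x) (f y) = d x y))"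

definition pseudorectangle :: "'a set \<Rightarrow> ('a \<Rightarrow> 'a \<Rightarrow> real) \<Rightarrow> bool" where
  "pseudorectangle X d \<longleftrightarrow> pseudometric_on X d \<and>
     (\<forall>Y. metric_subspace X d Y \<and> card Y = 3 \<longrightarrow> strongly_rigid Y d) \<and>
     (\<forall>Y Z. metric_subspace X d Y \<and> card Y = 3 \<and> metric_subspace X d Z \<and> card Z = 3
        \<longrightarrow> isometric Y d Z d) \<and>
     (\<exists>Y. metric_subspace X d Y \<and> card Y = 4 \<and> (\<forall>x\<in>X. \<exists>y\<in>Y. d x y = 0))"

definition zero_dist_rel :: "'a set \<Rightarrow> ('a \<Rightarrow> 'a \<Rightarrow> real) \<Rightarrow> ('a \<times> 'a) set" where
  "zero_dist_rel X d = {(x, y). x \<in> X \<and> y \<in> X \<and> d x y = 0}"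

lemma equiv_zero_dist_rel:
  assumes "pseudometric_on X d"
  shows "equiv X (zero_dist_rel X d)"
proof (rule equivI)
  show "refl_on X (zero_dist_rel X d)"
    using assms by (auto simp: refl_on_def zero_dist_rel_def pseudometric_on_def)
  show "sym (zero_dist_rel X d)"
    using assms by (auto simp: sym_def zero_dist_rel_def pseudometric_on_def)
  show "trans (zero_dist_rel X d)"
  proof (rule transI)
    fix x y z
    assume "(x, y) \<in> zero_dist_rel X d" "(y, z) \<in> zero_dist_rel X d"
    then have "x \<in> X" "y \<in> X" "z \<in> X" "d x y = 0" "d y z = 0"
      by (auto simp: zero_dist_rel_def)
    moreover from this have "d x z \<le> d x y + d y z" "0 \<le> d x z"
      using assms unfolding pseudometric_on_def by blast+
    ultimately show "(x, z) \<in> zero_dist_rel X d"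
      by (simp add: zero_dist_rel_def)
  qed
qed (auto simp: zero_dist_rel_def)

definition dist_fiber :: "'a set \<Rightarrow> ('a \<Rightarrow> 'a \<Rightarrow> real) \<Rightarrow> real \<Rightarrow> ('a \<times> 'a) set" where
  "dist_fiber X d t = {(x, y). x \<in> X \<and> y \<in> X \<and> d x y = t}"

definition dist_partition :: "'a set \<Rightarrow> ('a \<Rightarrow> 'a \<Rightarrow> real) \<Rightarrow> ('a \<times> 'a) set set" where
  "dist_partition X d = dist_fiber X d ` {d x y |x y. x \<in> X \<and> y \<in> X}"

definition tensor3_blocks ::
  "'a set \<Rightarrow> 'a set \<Rightarrow> 'a set \<Rightarrow> 'a set \<Rightarrow> ('a \<times> 'a) set set" where
  "tensor3_blocks A B C D =
    {A \<times> A \<union> B \<times> B \<union> C \<times> C \<union> D \<times> D,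
     A \<times> B \<union> B \<times> A \<union> C \<times> D \<union> D \<times> C,
     A \<times> C \<union> C \<times> A \<union> B \<times> D \<union> D \<times> B,
     A \<times> D \<union> D \<times> A \<union> B \<times> C \<union> C \<times> B}"

text \<open>Meaningful only if \<open>Q\<close> has exactly four elements; lemma \<open>tensor3_eq\<close> shows that the
  description is then well defined, that is, independent of the numbering of the blocks.\<close>

definition tensor3 :: "'a set set \<Rightarrow> ('a \<times> 'a) set set" where
  "tensor3 Q = (THE R. \<exists>A B C D. distinct [A, B, C, D] \<and> Q = {A, B, C, D} \<and>
     R = tensor3_blocks A B C D)"

lemma tensor3_blocks_swap:
  "tensor3_blocks B A C D = tensor3_blocks A B C D"
  "tensor3_blocks A C B D = tensor3_blocks A B C D"
  "tensor3_blocks A B D C = tensor3_blocks A B C D"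
  unfolding tensor3_blocks_def by (simp_all add: Un_ac insert_commute)

lemma tensor3_blocks_unique:
  assumes "distinct [A, B, C, D]" "distinct [A', B', C', D']"
    and "{A, B, C, D} = {A', B', C', D'}"
  shows "tensor3_blocks A' B' C' D' = tensor3_blocks A B C D"
proof -
  have "A' \<in> {A, B, C, D}" "B' \<in> {A, B, C, D}" "C' \<in> {A, B, C, D}" "D' \<in> {A, B, C, D}"
    using assms(3) by auto
  then show ?thesis
    using assms(2)
    by (elim insertE emptyE; simp; metis tensor3_blocks_swap)
qed

lemma tensor3_eq:
  assumes "distinct [A, B, C, D]"
  shows "tensor3 {A, B, C, D} = tensor3_blocks A B C D"
  unfolding tensor3_def
proof (rule the_equality)
  show "\<exists>A' B' C' D'. distinct [A', B', C', D'] \<and> {A, B, C, D} = {A', B', C', D'} \<and>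
     tensor3_blocks A B C D = tensor3_blocks A' B' C' D'"
    using assms by blast
next
  fix R
  assume "\<exists>A' B' C' D'. distinct [A', B', C', D'] \<and> {A, B, C, D} = {A', B', C', D'} \<and>
     R = tensor3_blocks A' B' C' D'"
  then obtain A' B' C' D' where "distinct [A', B', C', D']"
    "{A, B, C, D} = {A', B', C', D'}" "R = tensor3_blocks A' B' C' D'"
    by (elim exE conjE)
  then show "R = tensor3_blocks A B C D"
    using tensor3_blocks_unique[OF assms] by simp
qed

end

theory Submission
  imports Defs
begin

text \<open>
  All three conditions say that the points of \<open>X\<close> can be labelled, surjectively, by the
  elements of the Klein four-group in such a way that two pairs of points have the same distance
  iff the sums of their labels agree. The blocks of \<open>tensor3\<close> are the fibres of the sum of labels.
  A three-point metric subspace carries all labels but one; translation by the sum of the two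
  missing labels is an isometry between two such subspaces. Conversely, if all triples
  out of four points are rigid with the same three distances, then opposite
  edges of the tetrahedron have equal length.
\<close>

section \<open>Arithmetic of labels in the Klein four-group\<close>

text \<open>This is Z/2 x Z/2 with addition as componentwise exclusive or. Every element is its own
  inverse, so the sum of two labels is also their difference.\<close>

definition klein_add :: "bool \<times> bool \<Rightarrow> bool \<times> bool \<Rightarrow> bool \<times> bool" (infixl "\<oplus>\<^sub>K" 65) where
  "a \<oplus>\<^sub>K b = (fst a \<noteq> fst b, snd a \<noteq> snd b)"

lemma klein_add_self: "a \<oplus>\<^sub>K a = (False, False)"
  by (simp add: klein_add_def)

lemma klein_add_eq_zero_iff: "a \<oplus>\<^sub>K b = (False, False) \<longleftrightarrow> a = b"
  by (auto simp: klein_add_def prod_eq_iff)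

lemma klein_add_cancel_right: "(a \<oplus>\<^sub>K c) \<oplus>\<^sub>K (b \<oplus>\<^sub>K c) = a \<oplus>\<^sub>K b"
  by (auto simp: klein_add_def)

lemma klein_add_add_self: "a \<oplus>\<^sub>K c \<oplus>\<^sub>K c = a"
  by (auto simp: klein_add_def prod_eq_iff)

lemma UNIV_klein: "(UNIV :: (bool \<times> bool) set) =
    {(False, False), (False, True), (True, False), (True, True)}"
  by auto

lemma card_UNIV_klein: "card (UNIV :: (bool \<times> bool) set) = 4"
  by (simp add: UNIV_klein)

text \<open>A nonzero sum is attained by exactly two unordered pairs of labels, and these are
  complementary. The excluded label \<open>s\<close> lies in one of them, so only the other
  remains.\<close>

lemma klein_add_rigid:
  assumes "a \<noteq> s" "b \<noteq> s" "u \<noteq> s" "v \<noteq> s" "a \<oplus>\<^sub>K b = u \<oplus>\<^sub>K v" "a \<noteq> b"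
  shows "{a, b} = {u, v}"
proof -
  have "(a = u \<and> b = v) \<or> (a = v \<and> b = u)"
    using assms unfolding klein_add_def prod_eq_iff by auto
  then show ?thesis by auto
qed

text \<open>Translation by the sum of \<open>s\<close> and \<open>t\<close> is an involution that
  exchanges \<open>s\<close> and \<open>t\<close>.\<close>

lemma bij_betw_klein_translate:
  "bij_betw (\<lambda>a. a \<oplus>\<^sub>K (s \<oplus>\<^sub>K t)) (- {s}) (- {t})"
proof (rule bij_betw_byWitness[where f' = "\<lambda>a. a \<oplus>\<^sub>K (s \<oplus>\<^sub>K t)"])
  have "a \<oplus>\<^sub>K (s \<oplus>\<^sub>K t) = t \<longleftrightarrow> a = s" "a \<oplus>\<^sub>K (s \<oplus>\<^sub>K t) = s \<longleftrightarrow> a = t" for a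
    by (cases a; cases s; cases t; auto simp: klein_add_def)+
  then show "(\<lambda>a. a \<oplus>\<^sub>K (s \<oplus>\<^sub>K t)) ` (- {s}) \<subseteq> - {t}" "(\<lambda>a. a \<oplus>\<^sub>K (s \<oplus>\<^sub>K t)) ` (- {t}) \<subseteq> - {s}"
    unfolding image_subset_iff Compl_iff singleton_iff by simp_all
qed (simp_all add: klein_add_add_self)

section \<open>Partitions as fibres of maps\<close>

text \<open>A common form for the partitions of \<open>X\<close> and of \<open>X \<times> X\<close>:
  equality of two such partitions becomes a statement about which elements the two maps
  identify.\<close>

definition kernel_partition :: "'a set \<Rightarrow> ('a \<Rightarrow> 'b) \<Rightarrow> 'a set set" where
  "kernel_partition S F = (\<lambda>p. {q\<in>S. F q = F p}) ` S"

lemma kernel_partition_eq_fibers: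
  "kernel_partition S F = (\<lambda>w. {q\<in>S. F q = w}) ` F ` S"
  by (auto simp: kernel_partition_def)

lemma kernel_partition_eq_iff:
  "kernel_partition S F = kernel_partition S G \<longleftrightarrow>
     (\<forall>p\<in>S. \<forall>q\<in>S. F p = F q \<longleftrightarrow> G p = G q)"
proof
  assume eq: "kernel_partition S F = kernel_partition S G"
  have "{q\<in>S. F q = F p} = {q\<in>S. G q = G p}" if p: "p \<in> S" for p
  proof -
    have "{q\<in>S. F q = F p} \<in> kernel_partition S G"
      unfolding eq[symmetric] using p by (auto simp: kernel_partition_def)
    then obtain r where r: "{q\<in>S. F q = F p} = {q\<in>S. G q = G r}"
      by (auto simp: kernel_partition_def)
    \<comment> \<open>The point \<open>p\<close> lies in its own class, so the representative
      \<open>r\<close> can be replaced by \<open>p\<close>.\<close>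
    with p have "G p = G r" by blast
    with r show ?thesis by simp
  qed
  then show "\<forall>p\<in>S. \<forall>q\<in>S. F p = F q \<longleftrightarrow> G p = G q" by blast
next
  assume "\<forall>p\<in>S. \<forall>q\<in>S. F p = F q \<longleftrightarrow> G p = G q"
  then show "kernel_partition S F = kernel_partition S G"
    unfolding kernel_partition_def by (intro image_cong) auto
qed

lemma dist_partition_eq_kernel_partition:
  "dist_partition X d = kernel_partition (X \<times> X) (\<lambda>(x, y). d x y)"
  unfolding kernel_partition_eq_fibers dist_partition_def dist_fiber_def
  by (intro arg_cong2[where f = image]) auto

text \<open>Any numbering of the four blocks by labels serves; each point takes the label of the
  block that contains it.\<close>

lemma partition_on_four_labelling:
  assumes Q: "partition_on X Q" "card Q = 4"
  obtains f :: "'a \<Rightarrow> bool \<times> bool" where "f ` X = UNIV" "Q = kernel_partition X f"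
proof -
  \<comment> \<open>Infinite sets have cardinality 0.\<close>
  have "finite Q" using Q(2) card.infinite by fastforce
  then obtain g :: "'a set \<Rightarrow> bool \<times> bool" where g: "bij_betw g Q UNIV"
    using finite_same_card_bij[of Q "UNIV :: (bool \<times> bool) set"] Q(2)
    by (auto simp: card_UNIV_klein)
  define block where "block x = (THE A. A \<in> Q \<and> x \<in> A)" for x
  have block: "block x = A" if "A \<in> Q" "x \<in> A" for x A
    unfolding block_def
  proof (rule the_equality)
    fix B assume "B \<in> Q \<and> x \<in> B"
    with that show "B = A"
      using Q(1) unfolding partition_on_def disjoint_def by blast
  qed (use that in simp)
  have inX: "A \<subseteq> X" "A \<noteq> {}" if "A \<in> Q" for A
    using Q(1) that unfolding partition_on_def by blast+
  have ex: "\<exists>A\<in>Q. x \<in> A" if "x \<in> X" for x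
    using Q(1) that unfolding partition_on_def by blast
  have blockQ: "block x \<in> Q" "x \<in> block x" if "x \<in> X" for x
    using ex[OF that] block by auto
  have imgb: "block ` X = Q"
  proof
    show "Q \<subseteq> block ` X" using inX block by fast
  qed (use blockQ in auto)
  have fib: "{q\<in>X. g (block q) = g (block p)} = block p" if p: "p \<in> X" for p
  proof -
    have "g (block q) = g (block p) \<longleftrightarrow> q \<in> block p" if "q \<in> X" for q
      using g blockQ[OF p] blockQ[OF that] block unfolding bij_betw_def inj_on_def by metis
    then show ?thesis using inX(1)[OF blockQ(1)[OF p]] by blast
  qed
  show thesis
  proof
    show "(g \<circ> block) ` X = UNIV"
      using g unfolding image_comp[symmetric] imgb by (simp add: bij_betw_def)
    show "Q = kernel_partition X (g \<circ> block)"
      unfolding kernel_partition_def by (simp add: fib imgb)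
  qed
qed

text \<open>The diagonal block of \<open>tensor3\<close> collects the pairs with label sum zero.
  Each other block collects one nonzero sum, which arises from two complementary pairs of
  labels.\<close>

lemma kernel_partition_klein:
  fixes f :: "'a \<Rightarrow> bool \<times> bool"
  assumes f: "f ` X = UNIV"
  shows card_kernel_partition_klein: "card (kernel_partition X f) = 4"
    and tensor3_kernel_partition_klein:
      "tensor3 (kernel_partition X f) = kernel_partition (X \<times> X) (\<lambda>(x, y). f x \<oplus>\<^sub>K f y)"
proof -
  define fib where "fib w = {x\<in>X. f x = w}" for w
  have fib_ne: "fib w \<noteq> {}" for w
  proof -
    have "w \<in> f ` X" using f by simp
    then show ?thesis by (auto simp: fib_def)
  qed
  have inj: "fib v \<noteq> fib w" if "v \<noteq> w" for v w
    using fib_ne[of v] that by (auto simp: fib_def)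
  let ?A = "fib (False, False)" and ?B = "fib (False, True)"
    and ?C = "fib (True, False)" and ?D = "fib (True, True)"
  have dist: "distinct [?A, ?B, ?C, ?D]"
    by (simp add: inj)
  have Q: "kernel_partition X f = {?A, ?B, ?C, ?D}"
    unfolding kernel_partition_eq_fibers f fib_def[symmetric] by (simp add: UNIV_klein)
  show "card (kernel_partition X f) = 4"
    unfolding Q using dist by simp
  \<comment> \<open>Pairing with a point \<open>x0\<close> of label zero realises every label as a
    sum, so there are four fibres and none is empty.\<close>
  have "(\<lambda>(x, y). f x \<oplus>\<^sub>K f y) ` (X \<times> X) = UNIV"
  proof -
    obtain x0 where x0: "x0 \<in> X" "f x0 = (False, False)"
      using fib_ne[of "(False, False)"] by (auto simp: fib_def)
    have "w \<in> (\<lambda>(x, y). f x \<oplus>\<^sub>K f y) ` (X \<times> X)" for w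
    proof -
      obtain x where "x \<in> X" "f x = w" using fib_ne[of w] by (auto simp: fib_def)
      with x0 show ?thesis
        by (intro image_eqI[of _ _ "(x, x0)"]) (auto simp: klein_add_def)
    qed
    then show ?thesis by blast
  qed
  then have "kernel_partition (X \<times> X) (\<lambda>(x, y). f x \<oplus>\<^sub>K f y) =
      (\<lambda>w. {q\<in>X \<times> X. (case q of (x, y) \<Rightarrow> f x \<oplus>\<^sub>K f y) = w}) ` UNIV"
    by (simp add: kernel_partition_eq_fibers)
  \<comment> \<open>The order of the labels in \<open>UNIV_klein\<close> matches the order of the
    blocks: for instance, both \<open>?A\<close> with \<open>?B\<close> and \<open>?C\<close> with
    \<open>?D\<close> have sum \<open>(False, True)\<close>.\<close>
  also have "\<dots> = tensor3_blocks ?A ?B ?C ?D"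
    unfolding UNIV_klein tensor3_blocks_def image_insert image_empty
    by (intro arg_cong2[where f = insert] refl)
      (auto simp: fib_def klein_add_def prod_eq_iff)
  also have "\<dots> = tensor3 (kernel_partition X f)"
    unfolding Q using tensor3_eq[OF dist] by simp
  finally show "tensor3 (kernel_partition X f) =
      kernel_partition (X \<times> X) (\<lambda>(x, y). f x \<oplus>\<^sub>K f y)" ..
qed

section \<open>Klein labellings of a pseudometric space\<close>

text \<open>Equivalently, on \<open>X\<close> the distance is an injective function of the sum of
  the labels, and all four labels occur.\<close>

definition klein_labelling :: "'a set \<Rightarrow> ('a \<Rightarrow> 'a \<Rightarrow> real) \<Rightarrow> ('a \<Rightarrow> bool \<times> bool) \<Rightarrow> bool" where
  "klein_labelling X d f \<longleftrightarrow> f ` X = UNIV \<and>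
     (\<forall>x\<in>X. \<forall>y\<in>X. \<forall>u\<in>X. \<forall>v\<in>X. d x y = d u v \<longleftrightarrow> f x \<oplus>\<^sub>K f y = f u \<oplus>\<^sub>K f v)"

lemma klein_labelling_iff_tensor3:
  assumes "f ` X = UNIV"
  shows "klein_labelling X d f \<longleftrightarrow> tensor3 (kernel_partition X f) = dist_partition X d"
  unfolding tensor3_kernel_partition_klein[OF assms] dist_partition_eq_kernel_partition
    kernel_partition_eq_iff klein_labelling_def
  using assms by auto

text \<open>Comparison with the pair \<open>x\<close>, \<open>x\<close>, whose distance and label
  sum are both zero.\<close>

lemma klein_labelling_dist_zero_iff:
  assumes "pseudometric_on X d" "klein_labelling X d f" "x \<in> X" "y \<in> X"
  shows "d x y = 0 \<longleftrightarrow> f x = f y"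
proof -
  have "d x y = d x x \<longleftrightarrow> f x \<oplus>\<^sub>K f y = f x \<oplus>\<^sub>K f x"
    using assms unfolding klein_labelling_def by blast
  moreover have "d x x = 0"
    using assms unfolding pseudometric_on_def by blast
  ultimately show ?thesis
    by (simp add: klein_add_self klein_add_eq_zero_iff)
qed

text \<open>Transfers what is known about the fibres of a labelling to the specific partition given
  by zero distance.\<close>

lemma quotient_zero_dist_rel_klein_labelling:
  assumes "pseudometric_on X d" "klein_labelling X d f"
  shows "X // zero_dist_rel X d = kernel_partition X f"
proof -
  have "zero_dist_rel X d `` {x} = {y\<in>X. f y = f x}" if "x \<in> X" for x
    using that klein_labelling_dist_zero_iff[OF assms that] by (auto simp: zero_dist_rel_def)
  then show ?thesis
    unfolding quotient_def kernel_partition_def by auto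
qed

lemma pseudometric_on_subset:
  "pseudometric_on X d \<Longrightarrow> Y \<subseteq> X \<Longrightarrow> pseudometric_on Y d"
  unfolding pseudometric_on_def by (meson subsetD)

section \<open>From a labelling to a pseudorectangle\<close>

lemma pseudorectangle_if_klein_labelling:
  assumes pm: "pseudometric_on X d" and lab: "klein_labelling X d f"
  shows "pseudorectangle X d"
proof -
  note zero_iff = klein_labelling_dist_zero_iff[OF pm lab]
  have eq_iff: "d x y = d u v \<longleftrightarrow> f x \<oplus>\<^sub>K f y = f u \<oplus>\<^sub>K f v"
    if "x \<in> X" "y \<in> X" "u \<in> X" "v \<in> X" for x y u v
    using lab that unfolding klein_labelling_def by blast
  have inj: "inj_on f Y" if "metric_subspace X d Y" for Y
  proof (rule inj_onI)
    fix x y assume "x \<in> Y" "y \<in> Y" "f x = f y"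
    with that show "x = y"
      using zero_iff[of x y] unfolding metric_subspace_def metric_on_def by blast
  qed
  \<comment> \<open>Labels are injective on metric subspaces, so three points use three of the four
    labels and miss exactly one.\<close>
  have triple: "\<exists>s. bij_betw f Y (- {s})" if Y: "metric_subspace X d Y" "card Y = 3" for Y
  proof -
    have "card (- (f ` Y)) = 1"
      using card_image[OF inj[OF Y(1)]] Y(2) card_Diff_subset[of "f ` Y" UNIV]
      by (simp add: Compl_eq_Diff_UNIV card_UNIV_klein)
    then obtain s where "- (f ` Y) = {s}" by (auto simp: card_1_singleton_iff)
    then have "f ` Y = - {s}" by auto
    with inj[OF Y(1)] show ?thesis by (auto simp: bij_betw_def)
  qed
  have "strongly_rigid Y d" if Y: "metric_subspace X d Y" "card Y = 3" for Y
    unfolding strongly_rigid_def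
  proof (intro conjI ballI impI)
    show "metric_on Y d" using Y(1) by (simp add: metric_subspace_def)
    obtain s where s: "bij_betw f Y (- {s})" using triple[OF Y] by blast
    have sub: "Y \<subseteq> X" using Y(1) by (simp add: metric_subspace_def)
    fix x y u v assume m: "x \<in> Y" "y \<in> Y" "u \<in> Y" "v \<in> Y"
      and e: "d x y = d u v \<and> d u v \<noteq> 0"
    have "x \<in> X" "y \<in> X" "u \<in> X" "v \<in> X" using m sub by blast+
    then have "f x \<oplus>\<^sub>K f y = f u \<oplus>\<^sub>K f v" "f x \<noteq> f y"
      using e eq_iff[of x y u v] zero_iff[of x y] by auto
    moreover have "f w \<noteq> s" if "w \<in> Y" for w
      using that bij_betwE[OF s] by auto
    ultimately have "{f x, f y} = {f u, f v}"
      using m by (intro klein_add_rigid[where s = s])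
    then have "f ` {x, y} = f ` {u, v}" by simp
    then show "{x, y} = {u, v}"
      using inj_on_image_eq_iff[OF inj[OF Y(1)], of "{x, y}" "{u, v}"] m by simp
  qed
  moreover have "isometric Y d Z d"
    if Y: "metric_subspace X d Y" "card Y = 3" and Z: "metric_subspace X d Z" "card Z = 3" for Y Z
  proof -
    obtain s where s: "bij_betw f Y (- {s})" using triple[OF Y] by blast
    obtain t where t: "bij_betw f Z (- {t})" using triple[OF Z] by blast
    \<comment> \<open>The translation moves the missing label of \<open>Y\<close> to that of
      \<open>Z\<close>; \<open>h\<close> lifts it to points. Distances survive because the
      translation cancels in the sum of two labels.\<close>
    define T where "T a = a \<oplus>\<^sub>K (s \<oplus>\<^sub>K t)" for a
    define h where "h = inv_into Z f \<circ> (T \<circ> f)"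
    have T: "bij_betw (T \<circ> f) Y (- {t})"
      using bij_betw_trans[OF s bij_betw_klein_translate[of s t]] unfolding T_def comp_def .
    have h: "bij_betw h Y Z"
      unfolding h_def using bij_betw_trans[OF T bij_betw_inv_into[OF t]] .
    have fh: "f (h y) = T (f y)" if "y \<in> Y" for y
    proof -
      have "T (f y) \<in> f ` Z"
        using T t that by (auto simp: bij_betw_def)
      then show ?thesis by (simp add: h_def f_inv_into_f)
    qed
    have "d (h x) (h y) = d x y" if "x \<in> Y" "y \<in> Y" for x y
    proof -
      have "h x \<in> X" "h y \<in> X" "x \<in> X" "y \<in> X"
        using that bij_betwE[OF h] Y(1) Z(1) unfolding metric_subspace_def by blast+
      then show ?thesis
        using that by (simp add: eq_iff fh T_def klein_add_cancel_right)
    qed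
    with h show ?thesis unfolding isometric_def by blast
  qed
  moreover have "\<exists>Y. metric_subspace X d Y \<and> card Y = 4 \<and> (\<forall>x\<in>X. \<exists>y\<in>Y. d x y = 0)"
  proof -
    have surj: "f ` X = UNIV" using lab by (simp add: klein_labelling_def)
    \<comment> \<open>One chosen point for each label gives the four-point subspace.\<close>
    let ?g = "inv_into X f"
    have g: "?g w \<in> X" "f (?g w) = w" for w
      using surj by (simp_all add: inv_into_into f_inv_into_f)
    have injg: "inj ?g" by (metis g(2) injI)
    have sub: "range ?g \<subseteq> X" using g by auto
    have "metric_on (range ?g) d"
      unfolding metric_on_def
      using pseudometric_on_subset[OF pm sub] zero_iff g by auto
    moreover have "card (range ?g) = 4"
      using card_image[OF injg] card_UNIV_klein by simp
    moreover have "d x (?g (f x)) = 0" if "x \<in> X" for x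
      using zero_iff that g by simp
    ultimately show ?thesis
      using sub unfolding metric_subspace_def by blast
  qed
  ultimately show ?thesis
    using pm unfolding pseudorectangle_def by blast
qed

section \<open>From a pseudorectangle to a labelling\<close>

text \<open>An invariant that allows triples to be compared without following the bijection.
  Injectivity makes distinct points correspond to distinct points.\<close>

lemma isometric_dist_set_eq:
  assumes "isometric Y d Z e"
  shows "{d x y |x y. x \<in> Y \<and> y \<in> Y \<and> x \<noteq> y} = {e x y |x y. x \<in> Z \<and> y \<in> Z \<and> x \<noteq> y}"
proof -
  obtain h where h: "inj_on h Y" "h ` Y = Z" and
    e: "\<And>x y. x \<in> Y \<Longrightarrow> y \<in> Y \<Longrightarrow> e (h x) (h y) = d x y"
    using assms unfolding isometric_def bij_betw_def by blast
  have "{e x y |x y. x \<in> h ` Y \<and> y \<in> h ` Y \<and> x \<noteq> y} =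
      {e (h x) (h y) |x y. x \<in> Y \<and> y \<in> Y \<and> h x \<noteq> h y}" by blast
  also have "\<dots> = {d x y |x y. x \<in> Y \<and> y \<in> Y \<and> x \<noteq> y}"
    using e h(1) unfolding inj_on_def by (intro Collect_cong) metis
  finally show ?thesis using h(2) by simp
qed

text \<open>Two triangle inequalities in each direction; this permits replacing points by
  representatives at distance zero.\<close>

lemma pseudometric_on_dist_cong:
  assumes pm: "pseudometric_on X d" and X: "x \<in> X" "x' \<in> X" "y \<in> X" "y' \<in> X"
    and "d x x' = 0" "d y y' = 0"
  shows "d x y = d x' y'"
proof -
  have tri: "d a c \<le> d a b + d b c" if "a \<in> X" "b \<in> X" "c \<in> X" for a b c
    using pm that unfolding pseudometric_on_def by blast
  have "d x' x = 0" "d y' y = 0"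
    using assms unfolding pseudometric_on_def by metis+
  then show ?thesis
    using assms(6,7) tri[of x x' y] tri[of x' y' y] tri[of x' x y'] tri[of x y y'] X by linarith
qed

lemma klein_labelling_if_pseudorectangle:
  assumes pr: "pseudorectangle X d"
  obtains f where "klein_labelling X d f"
proof -
  have pm: "pseudometric_on X d" using pr by (simp add: pseudorectangle_def)
  obtain Y where Y: "metric_subspace X d Y" "card Y = 4" and
    dense: "\<And>x. x \<in> X \<Longrightarrow> \<exists>y\<in>Y. d x y = 0"
    using pr unfolding pseudorectangle_def by blast
  have YX: "Y \<subseteq> X" and mY: "metric_on Y d"
    using Y(1) by (simp_all add: metric_subspace_def)
  have "card Y = card (UNIV :: (bool \<times> bool) set)" "finite Y"
    using Y(2) card.infinite by (fastforce simp: card_UNIV_klein)+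
  \<comment> \<open>An arbitrary numbering of the four points suffices, since opposite edges will
    turn out equal in all three directions.\<close>
  then obtain l :: "'a \<Rightarrow> bool \<times> bool" where l: "bij_betw l Y UNIV"
    using finite_same_card_bij[of Y "UNIV :: (bool \<times> bool) set"] by auto
  let ?p = "inv_into Y l"
  have p: "bij_betw ?p UNIV Y" using bij_betw_inv_into[OF l] .
  define a b c e where abce: "a = ?p (False, False)" "b = ?p (False, True)"
    "c = ?p (True, False)" "e = ?p (True, True)"
  have labs: "l a = (False, False)" "l b = (False, True)" "l c = (True, False)" "l e = (True, True)"
    using l unfolding abce by (simp_all add: bij_betw_inv_into_right)
  have Yeq: "Y = {a, b, c, e}"
  proof -
    have "Y = ?p ` UNIV" using p by (simp add: bij_betw_def)
    then show ?thesis unfolding UNIV_klein abce by simp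
  qed
  have ne: "a \<noteq> b" "a \<noteq> c" "a \<noteq> e" "b \<noteq> c" "b \<noteq> e" "c \<noteq> e"
    using labs by auto
  have sym: "d x y = d y x" if "x \<in> Y" "y \<in> Y" for x y
    using mY that unfolding metric_on_def pseudometric_on_def by blast
  have refl: "d x x = 0" if "x \<in> Y" for x
    using mY that unfolding metric_on_def pseudometric_on_def by blast
  have nz: "d x y \<noteq> 0" if "x \<in> Y" "y \<in> Y" "x \<noteq> y" for x y
    using mY that unfolding metric_on_def by blast
  have sub: "metric_subspace X d T" if T: "T \<subseteq> Y" for T
    unfolding metric_subspace_def metric_on_def
  proof (intro conjI ballI impI)
    show "T \<subseteq> X" using T YX by blast
    then show "pseudometric_on T d" by (rule pseudometric_on_subset[OF pm])
    show "x = y" if "x \<in> T" "y \<in> T" "d x y = 0" for x y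
      using nz that T by blast
  qed
  \<comment> \<open>Edges with a common vertex span a strongly rigid triple, so they have different
    lengths.\<close>
  have rigid: "d x y \<noteq> d y z" if "x \<in> Y" "y \<in> Y" "z \<in> Y" "x \<noteq> y" "y \<noteq> z" "x \<noteq> z" for x y z
  proof
    assume eq: "d x y = d y z"
    have "strongly_rigid {x, y, z} d"
      using pr sub[of "{x, y, z}"] that unfolding pseudorectangle_def by simp
    then have "{x, y} = {y, z}"
      using eq nz[of y z] that unfolding strongly_rigid_def by blast
    with that show False by (auto simp: doubleton_eq_iff)
  qed
  have dset: "{d x y |x y. x \<in> {u, v, w} \<and> y \<in> {u, v, w} \<and> x \<noteq> y} = {d u v, d u w, d v w}"
    (is "?L = ?R")
    if uvw: "u \<in> Y" "v \<in> Y" "w \<in> Y" "u \<noteq> v" "v \<noteq> w" "u \<noteq> w" for u v w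
  proof
    show "?R \<subseteq> ?L" using uvw(4-6) by blast
    have "d v u = d u v" "d w u = d u w" "d w v = d v w" using sym uvw by simp_all
    then show "?L \<subseteq> ?R" by auto
  qed
  have iso: "{d u v, d u w, d v w} = {d u' v', d u' w', d v' w'}"
    if "u \<in> Y" "v \<in> Y" "w \<in> Y" "u \<noteq> v" "v \<noteq> w" "u \<noteq> w"
      "u' \<in> Y" "v' \<in> Y" "w' \<in> Y" "u' \<noteq> v'" "v' \<noteq> w'" "u' \<noteq> w'" for u v w u' v' w'
  proof -
    have "isometric {u, v, w} d {u', v', w'} d"
      using pr sub[of "{u, v, w}"] sub[of "{u', v', w'}"] that
      unfolding pseudorectangle_def by simp
    from isometric_dist_set_eq[OF this] show ?thesis
      using dset that by simp
  qed
  have mem: "a \<in> Y" "b \<in> Y" "c \<in> Y" "e \<in> Y" using Yeq by auto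
  \<comment> \<open>Comparing the face \<open>a\<close>, \<open>b\<close>, \<open>c\<close> with two
    faces through \<open>e\<close> confines every edge at \<open>e\<close> to the three lengths of
    that face.\<close>
  have "{d a b, d a c, d b c} = {d a b, d a e, d b e}"
    using iso[of a b c a b e] mem ne by simp
  then have in1: "d a e \<in> {d a b, d a c, d b c}" "d b e \<in> {d a b, d a c, d b c}"
    by simp_all
  have "{d a b, d a c, d b c} = {d a c, d a e, d c e}"
    using iso[of a b c a c e] mem ne by simp
  then have in2: "d c e \<in> {d a b, d a c, d b c}"
    by simp
  have diff: "d a b \<noteq> d b c" "d a b \<noteq> d a c" "d a c \<noteq> d b c"
    using rigid[of a b c] rigid[of b a c] rigid[of a c b] mem ne sym[of a b] sym[of b c] by simp_all
  have diff_e: "d a e \<noteq> d a b" "d b e \<noteq> d a b" "d a e \<noteq> d a c" "d c e \<noteq> d a c"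
    "d b e \<noteq> d a e" "d c e \<noteq> d a e"
    using rigid[of b a e] rigid[of a b e] rigid[of c a e] rigid[of a c e] rigid[of a e b]
      rigid[of a e c] mem ne sym[of a b] sym[of a c] sym[of b e] sym[of c e] by simp_all
  \<comment> \<open>The edge from \<open>a\<close> to \<open>e\<close> meets the edges of lengths
    \<open>d a b\<close> and \<open>d a c\<close>, so only \<open>d b c\<close> is left. The other
    two edges at \<open>e\<close> must also avoid this value, and each meets one further edge of the
    face, which determines them.\<close>
  have opp_ae: "d a e = d b c" using in1(1) diff_e by simp
  then have opp: "d a e = d b c" "d b e = d a c" "d c e = d a b"
    using in1(2) in2 diff_e by simp_all
  \<comment> \<open>Reads the distance off the label sum; the last case is the sum
    \<open>(True, True)\<close>, shared by \<open>b\<close>, \<open>c\<close> and \<open>a\<close>,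
    \<open>e\<close>. Injectivity holds because the three edge lengths of the face are nonzero and
    distinct.\<close>
  define g where "g w = (if w = (False, False) then 0 else if w = (False, True) then d a b
     else if w = (True, False) then d a c else d b c)" for w
  have "inj g"
    using diff nz[OF mem(1,2) ne(1)] nz[OF mem(1,3) ne(2)] nz[OF mem(2,3) ne(4)]
    unfolding g_def inj_def by (auto split: if_splits)
  have dY: "d x y = g (l x \<oplus>\<^sub>K l y)" if "x \<in> Y" "y \<in> Y" for x y
    using that refl[OF mem(1)] refl[OF mem(2)] refl[OF mem(3)] refl[OF mem(4)] opp
      sym[OF mem(2) mem(1)] sym[OF mem(3) mem(1)] sym[OF mem(4) mem(1)]
      sym[OF mem(3) mem(2)] sym[OF mem(4) mem(2)] sym[OF mem(4) mem(3)]
    unfolding Yeq by (elim insertE emptyE) (simp_all add: labs klein_add_def g_def)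
  \<comment> \<open>A choice of a point of \<open>Y\<close> at distance zero extends the labels from
    \<open>Y\<close> to \<open>X\<close>.\<close>
  obtain r where r: "\<And>x. x \<in> X \<Longrightarrow> r x \<in> Y \<and> d x (r x) = 0"
    using dense by metis
  have dX: "d x y = g (l (r x) \<oplus>\<^sub>K l (r y))" if "x \<in> X" "y \<in> X" for x y
  proof -
    have "d x y = d (r x) (r y)"
      using r[OF that(1)] r[OF that(2)] that YX by (intro pseudometric_on_dist_cong[OF pm]) auto
    then show ?thesis using dY r that by simp
  qed
  \<comment> \<open>Points of the metric subspace \<open>Y\<close> at distance zero coincide. Hence
    \<open>r\<close> fixes \<open>Y\<close>, and all labels still occur after the extension.\<close>
  have rY: "r y = y" if "y \<in> Y" for y
    using r[OF subsetD[OF YX that]] nz[OF that, of "r y"] by metis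
  have "(l \<circ> r) ` X = UNIV"
  proof -
    have "UNIV = l ` Y" using l by (simp add: bij_betw_def)
    also have "\<dots> = (l \<circ> r) ` Y" using rY by simp
    also have "\<dots> \<subseteq> (l \<circ> r) ` X" using YX by (rule image_mono)
    finally show ?thesis by blast
  qed
  then have "klein_labelling X d (l \<circ> r)"
    unfolding klein_labelling_def using dX \<open>inj g\<close> by (simp add: inj_eq)
  then show thesis by (rule that)
qed

theorem theorem5p6:
  fixes X :: "'a set" and d :: "'a \<Rightarrow> 'a \<Rightarrow> real"
  assumes "X \<noteq> {}" and "pseudometric_on X d"
  shows "(pseudorectangle X d \<longleftrightarrow>
            (\<forall>Q. Q = X // zero_dist_rel X d \<longrightarrow> card Q = 4 \<and> tensor3 Q = dist_partition X d)) \<and>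
         ((\<forall>Q. Q = X // zero_dist_rel X d \<longrightarrow> card Q = 4 \<and> tensor3 Q = dist_partition X d) \<longleftrightarrow>
            (\<exists>Q. partition_on X Q \<and> card Q = 4 \<and> tensor3 Q = dist_partition X d))"
    (is "(?i \<longleftrightarrow> ?ii) \<and> (_ \<longleftrightarrow> ?iii)")
proof -
  \<comment> \<open>The conditions are linked in a cycle: a labelling yields the quotient condition,
    the quotient itself witnesses the existential one, and any such partition can be
    labelled.\<close>
  have "?ii" if ?i
  proof -
    obtain f where f: "klein_labelling X d f"
      using klein_labelling_if_pseudorectangle[OF \<open>?i\<close>] .
    then have surj: "f ` X = UNIV" by (simp add: klein_labelling_def)
    show ?thesis
      using f quotient_zero_dist_rel_klein_labelling[OF assms(2) f]
        klein_labelling_iff_tensor3[OF surj] card_kernel_partition_klein[OF surj] by simp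
  qed
  moreover have "?iii" if ?ii
    using that partition_on_quotient[OF equiv_zero_dist_rel[OF assms(2)]] by blast
  moreover have "?i" if iii: ?iii
  proof -
    obtain Q where Q: "partition_on X Q" "card Q = 4" "tensor3 Q = dist_partition X d"
      using iii by blast
    obtain f :: "'a \<Rightarrow> bool \<times> bool" where "f ` X = UNIV" "Q = kernel_partition X f"
      using partition_on_four_labelling[OF Q(1,2)] .
    with Q(3) have "klein_labelling X d f"
      using klein_labelling_iff_tensor3 by metis
    then show ?thesis
      by (rule pseudorectangle_if_klein_labelling[OF assms(2)])
  qed
  ultimately show ?thesis by blast
qed

end
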